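(* Let $\alpha>0$ and $\rho>0$ be fixed and, for $\lambda>0$, let $$\varphi_{\alpha\delta,\rho}(x)=\Big(\frac{\sqrt\lambda\,\rho}{2\sqrt2}+\frac{\alpha}{\sqrt{2\lambda}}\Big)\operatorname{sech}\Big(\Big(\frac{\lambda\rho}4+\frac\alpha2\Big)(|x|-\bar x_{\alpha,\rho,\lambda})\Big),\qquad \bar x_{\alpha,\rho,\lambda}=\frac{2}{\lambda\rho+2\alpha}\log\frac{\lambda\rho}{\lambda\rho+4\alpha}.$$ Then $$\varphi_{\alpha\delta,\rho}\longrightarrow\sqrt{\frac{\rho\alpha}2}\,e^{-\frac\alpha2|\cdot|}\quad\text{in }H^1(\mathbb R),\qquad\text{as }\lambda\to0+.$$
   Context: The function $\varphi_{\alpha\delta,\rho}$ is the stationary state (ground state) of squared $L^2$-norm $\rho$ of the cubic focusing nonlinear Schrödinger equation with nonlinearity coefficient $\lambda$ and attractive Dirac delta potential $-\alpha\delta_0$ on the line. *)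

theory Defs
  imports "HOL-Analysis.Analysis"
begin

text \<open>
  Real-valued \<open>L\<^sup>2(\<real>)\<close> and \<open>H\<^sup>1(\<real>)\<close>, as sets of (Borel measurable) representatives rather than
  of equivalence classes modulo almost-everywhere equality.
\<close>

definition L2_space :: "(real \<Rightarrow> real) set" where
  "L2_space = {u \<in> borel_measurable lborel. integrable lborel (\<lambda>x. (u x)\<^sup>2)}"

definition locally_integrable :: "(real \<Rightarrow> real) \<Rightarrow> bool" where
  "locally_integrable u \<longleftrightarrow> (\<forall>K. compact K \<longrightarrow> set_integrable lborel K u)"

definition test_function :: "(real \<Rightarrow> real) \<Rightarrow> bool" where
  "test_function \<eta> \<longleftrightarrow>
     (\<forall>n. (deriv ^^ n) \<eta> differentiable_on UNIV) \<and> compact (closure {x. \<eta> x \<noteq> 0})"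

definition has_weak_deriv :: "(real \<Rightarrow> real) \<Rightarrow> (real \<Rightarrow> real) \<Rightarrow> bool" where
  "has_weak_deriv u v \<longleftrightarrow> locally_integrable u \<and> locally_integrable v \<and>
     (\<forall>\<eta>. test_function \<eta> \<longrightarrow>
        (LINT x|lborel. u x * deriv \<eta> x) = - (LINT x|lborel. v x * \<eta> x))"

definition H1_space :: "(real \<Rightarrow> real) set" where
  "H1_space = {u \<in> L2_space. \<exists>v \<in> L2_space. has_weak_deriv u v}"

text \<open>
  The weak derivative is determined only up to a null set; the norm below does not depend on the
  representative that is chosen.
\<close>

definition weak_deriv :: "(real \<Rightarrow> real) \<Rightarrow> real \<Rightarrow> real" where
  "weak_deriv u = (SOME v. v \<in> L2_space \<and> has_weak_deriv u v)"

definition H1_norm :: "(real \<Rightarrow> real) \<Rightarrow> real" where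
  "H1_norm u = sqrt ((LINT x|lborel. (u x)\<^sup>2) + (LINT x|lborel. (weak_deriv u x)\<^sup>2))"

definition sech :: "real \<Rightarrow> real" where
  "sech x = 1 / cosh x"

text \<open>In the following definitions \<open>l\<close> is the nonlinearity coefficient.\<close>

definition ground_state_shift :: "real \<Rightarrow> real \<Rightarrow> real \<Rightarrow> real" where
  "ground_state_shift \<alpha> \<rho> l = 2 / (l * \<rho> + 2 * \<alpha>) * ln (l * \<rho> / (l * \<rho> + 4 * \<alpha>))"

definition ground_state :: "real \<Rightarrow> real \<Rightarrow> real \<Rightarrow> real \<Rightarrow> real" where
  "ground_state \<alpha> \<rho> l x =
     (sqrt l * \<rho> / (2 * sqrt 2) + \<alpha> / sqrt (2 * l)) *
     sech ((l * \<rho> / 4 + \<alpha> / 2) * (\<bar>x\<bar> - ground_state_shift \<alpha> \<rho> l))"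

end

theory Submission
  imports Defs
begin

text \<open>
  As \<open>l\<close> tends to \<open>0\<close>, the amplitude of the ground state diverges while its shift tends to
  \<open>-\<infinity>\<close>. The two effects cancel: with \<open>k = l * \<rho> / 4 + \<alpha> / 2\<close> and
  \<open>q = l * \<rho> / (l * \<rho> + 4 * \<alpha>)\<close>, expanding the hyperbolic cosine gives

    \<open>ground_state \<alpha> \<rho> l x = C * exp (- k * \<bar>x\<bar>) / (1 + q * exp (- 2 * k * \<bar>x\<bar>))\<close>

  for a coefficient \<open>C\<close> that converges to \<open>sqrt (\<rho> * \<alpha> / 2)\<close>
  (\<open>ground_state_eq_profile\<close>). Moreover \<open>k\<close> decreases to \<open>\<alpha> / 2\<close> and \<open>q\<close> tends to \<open>0\<close>, so
  the ground states and their derivatives away from \<open>0\<close> converge pointwise. Both are bounded by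
  a multiple of \<open>exp (- (\<alpha> / 2) * \<bar>x\<bar>)\<close> that is uniform for small \<open>l\<close>, and dominated
  convergence, applied to the squares of the differences to the limit, shows that their
  \<open>L\<^sup>2\<close> norms tend to \<open>0\<close> (\<open>profile_H1_convergence\<close>).

  It remains to identify these derivatives with the weak derivatives in the norm. Integration
  by parts shows that the classical derivative of a continuous function which is differentiable
  off a finite set is a weak derivative, provided that it is locally integrable
  (\<open>has_weak_deriv_piecewise\<close>). The norm is defined with an arbitrary choice of weak
  derivative, so one needs that weak derivatives are unique almost everywhere
  (\<open>weak_deriv_unique\<close>). This follows from the fundamental lemma of the calculus of variations,
  for which smooth compactly supported functions have to be constructed: products of dilated and
  translated copies of \<open>exp (- 1 / x)\<close>, which approximate indicators of intervals.
\<close>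

section \<open>Smooth bumps that approximate the indicator of an interval\<close>

text \<open>
  For \<open>p = 1\<close> this is the classical smooth function that vanishes to infinite order at \<open>0\<close>.
  Carrying the polynomial \<open>p\<close> makes the family closed under differentiation.
\<close>

definition flat :: "real poly \<Rightarrow> real \<Rightarrow> real" where
  "flat p x = (if 0 < x then poly p (1 / x) * exp (- (1 / x)) else 0)"

definition flat_deriv :: "real poly \<Rightarrow> real poly" where
  "flat_deriv p = [:0, 0, 1:] * (p - pderiv p)"

text \<open>
  The reason why \<^term>\<open>flat p\<close> is differentiable at the gluing point: the substitution \<open>t = 1 / x\<close>
  turns difference quotients there into a polynomial divided by the exponential.
\<close>

lemma poly_div_exp_tendsto_0:
  fixes p :: "real poly"
  shows "((\<lambda>t. poly p t / exp t) \<longlongrightarrow> 0) at_top"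
proof -
  have "((\<lambda>t. \<Sum>i\<le>degree p. coeff p i * (t ^ i / exp t)) \<longlongrightarrow> (\<Sum>i\<le>degree p. coeff p i * 0)) at_top"
    by (intro tendsto_intros tendsto_power_div_exp_0)
  then show ?thesis
    by (simp add: poly_altdef sum_divide_distrib)
qed

lemma flat_zero: "flat p 0 = 0"
  by (simp add: flat_def)

lemma flat_has_deriv: "(flat p has_real_derivative flat (flat_deriv p) x) (at x)"
proof -
  consider "x < 0" | "x = 0" | "x > 0" by linarith
  then show ?thesis
  proof cases
    case 1
    have "((\<lambda>_. 0) has_real_derivative 0) (at x)" by simp
    moreover have "eventually (\<lambda>y. y < 0) (nhds x)"
      using 1 by (intro order_tendstoD[OF filterlim_ident])
    then have "eventually (\<lambda>y. 0 = flat p y) (nhds x)"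
      by eventually_elim (simp add: flat_def)
    ultimately have "(flat p has_real_derivative 0) (at x)"
      using DERIV_cong_ev[of x x "\<lambda>_. 0" "flat p" 0 0] by simp
    then show ?thesis using 1 by (simp add: flat_def)
  next
    case 2
    have R: "((\<lambda>h. flat p h / h) \<longlongrightarrow> 0) (at_right 0)"
    proof -
      \<comment> \<open>The factor \<open>1 / h\<close> of the difference quotient raises the degree of \<open>p\<close> by one.\<close>
      have "((\<lambda>h. poly (pCons 0 p) (inverse h) / exp (inverse h)) \<longlongrightarrow> 0) (at_right 0)"
        by (rule filterlim_compose[OF poly_div_exp_tendsto_0 filterlim_inverse_at_top_right])
      moreover have "eventually (\<lambda>h. poly (pCons 0 p) (inverse h) / exp (inverse h) = flat p h / h)
          (at_right 0)"
        unfolding eventually_at_right_field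
        by (rule exI[of _ 1]) (simp add: flat_def exp_minus field_simps)
      ultimately show ?thesis by (rule Lim_transform_eventually)
    qed
    have L: "((\<lambda>h. flat p h / h) \<longlongrightarrow> 0) (at_left 0)"
    proof (rule Lim_transform_eventually[of "\<lambda>_. 0"])
      show "eventually (\<lambda>h. 0 = flat p h / h) (at_left 0)"
        unfolding eventually_at_left_field by (rule exI[of _ "-1"]) (simp add: flat_def)
    qed simp
    have "((\<lambda>h. flat p h / h) \<longlongrightarrow> 0) (at 0)"
      using L R by (simp add: filterlim_split_at)
    then show ?thesis
      using 2 by (simp add: DERIV_def flat_zero)
  next
    case 3
    have "((\<lambda>y. 1 / y) has_real_derivative - (1 / x)\<^sup>2) (at x)"
      using 3 by (auto intro!: derivative_eq_intros simp: power2_eq_square)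
    then have "((\<lambda>y. poly p (1 / y) * exp (- (1 / y))) has_real_derivative
            poly p (1 / x) * (exp (- (1 / x)) * - (- (1 / x)\<^sup>2)) +
            poly (pderiv p) (1 / x) * (- (1 / x)\<^sup>2) * exp (- (1 / x))) (at x)"
      by (intro DERIV_mult' DERIV_chain2[OF poly_DERIV] DERIV_chain2[OF DERIV_exp] DERIV_minus)
    also have "poly p (1 / x) * (exp (- (1 / x)) * - (- (1 / x)\<^sup>2)) +
            poly (pderiv p) (1 / x) * (- (1 / x)\<^sup>2) * exp (- (1 / x)) =
            poly (flat_deriv p) (1 / x) * exp (- (1 / x))"
      by (simp add: flat_deriv_def power2_eq_square algebra_simps)
    finally have "((\<lambda>y. poly p (1 / y) * exp (- (1 / y))) has_real_derivative
            poly (flat_deriv p) (1 / x) * exp (- (1 / x))) (at x)" .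
    moreover have "eventually (\<lambda>y. 0 < y) (nhds x)"
      using 3 by (intro order_tendstoD[OF filterlim_ident])
    then have "eventually (\<lambda>y. poly p (1 / y) * exp (- (1 / y)) = flat p y) (nhds x)"
      by eventually_elim (simp add: flat_def)
    ultimately have "(flat p has_real_derivative poly (flat_deriv p) (1 / x) * exp (- (1 / x))) (at x)"
      by (rule DERIV_cong_ev[OF refl _ refl, THEN iffD1, rotated])
    then show ?thesis using 3 by (simp add: flat_def)
  qed
qed

text \<open>
  A set of functions in which every member has its derivative in the set contains only smooth
  functions. The product rule leads from a product of two members of the flat family to a sum of
  two such products, so the closure of the products under addition is a set of this kind.
\<close>

inductive_set flat_products :: "real \<Rightarrow> real \<Rightarrow> real \<Rightarrow> (real \<Rightarrow> real) set"
  for a b n :: real where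
  product: "(\<lambda>x. flat p (n * (x - a)) * flat q (n * (b - x))) \<in> flat_products a b n"
| sum: "f \<in> flat_products a b n \<Longrightarrow> g \<in> flat_products a b n \<Longrightarrow>
        (\<lambda>x. f x + g x) \<in> flat_products a b n"

lemma flat_smult: "flat (smult c p) x = c * flat p x"
  by (simp add: flat_def)

lemma flat_products_deriv:
  assumes "f \<in> flat_products a b n"
  shows "\<exists>g\<in>flat_products a b n. \<forall>x. (f has_real_derivative g x) (at x)"
  using assms
proof induction
  case (product p q)
  let ?g = "\<lambda>x. flat (smult n (flat_deriv p)) (n * (x - a)) * flat q (n * (b - x)) +
                flat p (n * (x - a)) * flat (smult (-n) (flat_deriv q)) (n * (b - x))"
  have "((\<lambda>x. flat p (n * (x - a)) * flat q (n * (b - x))) has_real_derivative ?g x) (at x)" for x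
    by (rule derivative_eq_intros flat_has_deriv[THEN DERIV_chain2] refl)+
       (simp add: flat_smult del: smult_minus_left)
  moreover have "?g \<in> flat_products a b n"
    by (intro flat_products.intros)
  ultimately show ?case by (intro bexI[of _ ?g]) auto
next
  case (sum f g)
  then obtain f' g' where *: "f' \<in> flat_products a b n" "g' \<in> flat_products a b n"
    "\<forall>x. (f has_real_derivative f' x) (at x)" "\<forall>x. (g has_real_derivative g' x) (at x)"
    by blast
  then have "\<forall>x. ((\<lambda>x. f x + g x) has_real_derivative f' x + g' x) (at x)"
    by (auto intro!: derivative_eq_intros)
  with * show ?case
    by (intro bexI[of _ "\<lambda>x. f' x + g' x"] flat_products.sum) auto
qed

lemma flat_products_smooth:
  assumes "f \<in> flat_products a b n"
  shows "(deriv ^^ m) f \<in> flat_products a b n"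
proof (induction m)
  case (Suc m)
  then obtain g where g: "g \<in> flat_products a b n"
    "\<And>x. ((deriv ^^ m) f has_real_derivative g x) (at x)"
    using flat_products_deriv by blast
  then have "deriv ((deriv ^^ m) f) = g"
    by (intro ext DERIV_imp_deriv)
  with g show ?case by simp
qed (use assms in simp)

text \<open>
  Inside the interval the dilation by \<open>n + 1\<close> sends the exponents to \<open>0\<close> as \<open>n\<close> grows, so these
  bumps converge pointwise to the indicator of the open interval from \<open>a\<close> to \<open>b\<close>, and they stay
  below the indicator of the closed one. Testing against them therefore replaces a mollification argument.
\<close>

definition bump :: "real \<Rightarrow> real \<Rightarrow> nat \<Rightarrow> real \<Rightarrow> real" where
  "bump a b n x = flat 1 (real (Suc n) * (x - a)) * flat 1 (real (Suc n) * (b - x))"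

lemma bump_test_function: "test_function (bump a b n)"
proof -
  have "bump a b n \<in> flat_products a b (real (Suc n))"
    unfolding bump_def[abs_def] by (rule flat_products.product)
  then have "(deriv ^^ m) (bump a b n) differentiable_on UNIV" for m
    using flat_products_deriv[OF flat_products_smooth]
    by (meson differentiable_on_def differentiable_at_withinI real_differentiable_def)
  moreover have "{x. bump a b n x \<noteq> 0} \<subseteq> {a..b}"
    by (auto simp: bump_def flat_def zero_less_mult_iff split: if_splits)
  then have "closure {x. bump a b n x \<noteq> 0} \<subseteq> {a..b}"
    by (rule closure_minimal) simp
  then have "compact (closure {x. bump a b n x \<noteq> 0})"
    by (meson bounded_closed_interval bounded_subset closed_closure compact_eq_bounded_closed)
  ultimately show ?thesis by (simp add: test_function_def)
qed

lemma bump_bounds: "\<bar>bump a b n x\<bar> \<le> indicator {a..b} x"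
proof -
  have "0 \<le> flat 1 y" "flat 1 y \<le> 1" for y
    by (simp_all add: flat_def)
  then have "0 \<le> bump a b n x" "bump a b n x \<le> 1"
    by (simp_all add: bump_def mult_le_one)
  moreover have "bump a b n x = 0" if "x \<notin> {a..b}"
    using that by (auto simp: bump_def flat_def zero_less_mult_iff)
  ultimately show ?thesis
    by (auto simp: indicator_def)
qed

lemma bump_tendsto: "(\<lambda>n. bump a b n x) \<longlonglongrightarrow> indicator {a<..<b} x"
proof (cases "x \<in> {a<..<b}")
  case True
  have "(\<lambda>n. exp (- (inverse (real (Suc n)) * (1 / (x - a)))) *
              exp (- (inverse (real (Suc n)) * (1 / (b - x))))) \<longlonglongrightarrow>
        exp (- (0 * (1 / (x - a)))) * exp (- (0 * (1 / (b - x))))"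
    by (intro tendsto_intros LIMSEQ_inverse_real_of_nat)
  moreover have "flat 1 (real (Suc n) * y) = exp (- (inverse (real (Suc n)) * (1 / y)))"
    if "y > 0" for n y
    using that by (simp add: flat_def divide_inverse del: of_nat_Suc)
  ultimately show ?thesis
    using True by (simp add: bump_def del: of_nat_Suc)
next
  case False
  then have "bump a b n x = 0" for n
    by (auto simp: bump_def flat_def zero_less_mult_iff)
  with False show ?thesis
    by simp
qed

section \<open>Weak derivatives of piecewise differentiable functions\<close>

lemma locally_integrable_mult_integrable:
  assumes v: "locally_integrable v" and g: "continuous_on UNIV g"
    and supp: "\<And>x. x \<notin> {a..b} \<Longrightarrow> g x = 0"
  shows "integrable lborel (\<lambda>x. v x * g x)"
proof -
  have V: "integrable lborel (\<lambda>x. indicator {a..b} x * v x)"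
    using v by (simp add: locally_integrable_def set_integrable_def)
  have "compact (g ` {a..b})"
    by (intro compact_continuous_image continuous_on_subset[OF g]) auto
  then obtain B where B: "\<And>x. x \<in> {a..b} \<Longrightarrow> \<bar>g x\<bar> \<le> B"
    by (metis bounded_iff compact_imp_bounded imageI real_norm_def)
  have "integrable lborel (\<lambda>x. (indicator {a..b} x * v x) * g x)"
  proof (rule Bochner_Integration.integrable_bound)
    show "integrable lborel (\<lambda>x. B * (indicator {a..b} x * v x))"
      using V by simp
    have "g \<in> borel_measurable borel"
      using g by (rule borel_measurable_continuous_onI)
    then show "(\<lambda>x. (indicator {a..b} x * v x) * g x) \<in> borel_measurable lborel"
      using borel_measurable_integrable[OF V] by simp
    show "AE x in lborel. norm (indicator {a..b} x * v x * g x) \<le> norm (B * (indicator {a..b} x * v x))"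
    proof (rule AE_I2)
      fix x :: real
      show "norm (indicator {a..b} x * v x * g x) \<le> norm (B * (indicator {a..b} x * v x))"
        using mult_right_mono[OF order_trans[OF B abs_ge_self], of x "\<bar>v x\<bar>"]
        by (auto simp: indicator_def abs_mult mult.commute)
    qed
  qed
  also have "(\<lambda>x. (indicator {a..b} x * v x) * g x) = (\<lambda>x. v x * g x)"
  proof
    fix x
    show "(indicator {a..b} x * v x) * g x = v x * g x"
      using supp[of x] by (cases "x \<in> {a..b}") simp_all
  qed
  finally show ?thesis .
qed

text \<open>
  The interval is chosen with its end points outside the support, so that boundary terms vanish
  in an integration by parts over it.
\<close>

lemma test_function_supporting_interval:
  assumes "test_function \<eta>"
  obtains a b where "a \<le> b" "continuous_on UNIV \<eta>" "continuous_on UNIV (deriv \<eta>)"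
    "\<And>x. (\<eta> has_real_derivative deriv \<eta> x) (at x)"
    "\<eta> a = 0" "\<eta> b = 0" "\<And>x. x \<notin> {a..b} \<Longrightarrow> \<eta> x = 0" "\<And>x. x \<notin> {a..b} \<Longrightarrow> deriv \<eta> x = 0"
proof -
  have diff: "(deriv ^^ n) \<eta> differentiable_on UNIV" for n
    using assms by (simp add: test_function_def)
  have d0: "\<eta> differentiable_on UNIV" and d1: "deriv \<eta> differentiable_on UNIV"
    using diff[of 0] diff[of 1] by simp_all
  let ?K = "closure {x. \<eta> x \<noteq> 0}"
  have "compact ?K" using assms by (simp add: test_function_def)
  then obtain R where R: "\<And>x. x \<in> ?K \<Longrightarrow> \<bar>x\<bar> \<le> R"
    by (metis bounded_iff compact_imp_bounded real_norm_def)
  have z: "\<eta> x = 0" if "x \<notin> ?K" for x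
    using that closure_subset[of "{x. \<eta> x \<noteq> 0}"] by blast
  have dz: "deriv \<eta> x = 0" if "x \<notin> ?K" for x
  proof -
    have "eventually (\<lambda>y. y \<in> - ?K) (nhds x)"
      using that by (intro eventually_nhds_in_open) auto
    then have "eventually (\<lambda>y. \<eta> y = 0) (nhds x)"
      by (rule eventually_mono) (use z in blast)
    then have "(\<eta> has_real_derivative 0) (at x)"
      using DERIV_cong_ev[of x x \<eta> "\<lambda>_. 0" 0 0] by simp
    then show ?thesis by (rule DERIV_imp_deriv)
  qed
  define S where "S = \<bar>R\<bar> + 1"
  have S: "x \<notin> ?K" if "x \<notin> {-S<..<S}" for x
    using R[of x] that by (auto simp: S_def)
  show thesis
  proof (rule that[of "-S" S])
    show "(\<eta> has_real_derivative deriv \<eta> x) (at x)" for x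
      using d0 unfolding differentiable_on_def
      by (metis DERIV_deriv_iff_real_differentiable UNIV_I)
    show "-S \<le> S"
      by (simp add: S_def)
    show "continuous_on UNIV \<eta>" "continuous_on UNIV (deriv \<eta>)"
      by (rule differentiable_imp_continuous_on, rule d0 d1)+
    show "\<eta> (-S) = 0" "\<eta> S = 0"
      by (rule z, rule S, simp)+
    show "\<eta> x = 0" "deriv \<eta> x = 0" if "x \<notin> {-S..S}" for x
      by (rule z dz, rule S, use that in auto)+
  qed
qed

lemma locally_integrable_mult_test_function:
  assumes "locally_integrable v" "test_function \<eta>"
  shows "integrable lborel (\<lambda>x. v x * \<eta> x)"
  using test_function_supporting_interval[OF assms(2)] locally_integrable_mult_integrable[OF assms(1)] by metis

lemma continuous_imp_locally_integrable:
  "continuous_on UNIV u \<Longrightarrow> locally_integrable u"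
  unfolding locally_integrable_def set_integrable_def
  by (metis borel_integrable_compact continuous_on_subset subset_UNIV)

text \<open>
  Integration by parts: the product of \<open>u\<close> with a test function is continuous and differentiable
  off a finite set, so the fundamental theorem of calculus applies to it, and both boundary values
  are zero. Continuity of \<open>u\<close> is what excludes point masses in the derivative at the exceptional
  points.
\<close>

lemma has_weak_deriv_piecewise:
  assumes "finite S" and u: "continuous_on UNIV u" and v: "locally_integrable v"
    and deriv_u: "\<And>x. x \<notin> S \<Longrightarrow> (u has_real_derivative v x) (at x)"
  shows "has_weak_deriv u v"
  unfolding has_weak_deriv_def
proof (intro conjI allI impI)
  show lu: "locally_integrable u"
    using u by (rule continuous_imp_locally_integrable)
  fix \<eta> assume test: "test_function \<eta>"
  obtain a b where ab: "a \<le> b" "continuous_on UNIV \<eta>" "continuous_on UNIV (deriv \<eta>)"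
    and D: "\<And>x. (\<eta> has_real_derivative deriv \<eta> x) (at x)"
    and z: "\<eta> a = 0" "\<eta> b = 0" "\<And>x. x \<notin> {a..b} \<Longrightarrow> \<eta> x = 0" "\<And>x. x \<notin> {a..b} \<Longrightarrow> deriv \<eta> x = 0"
    using test_function_supporting_interval[OF test] by metis
  have I1: "integrable lborel (\<lambda>x. u x * deriv \<eta> x)"
    using lu ab(3) z(4) by (rule locally_integrable_mult_integrable)
  have I2: "integrable lborel (\<lambda>x. v x * \<eta> x)"
    using v test by (rule locally_integrable_mult_test_function)
  have "((\<lambda>x. u x * deriv \<eta> x + v x * \<eta> x) has_integral u b * \<eta> b - u a * \<eta> a) {a..b}"
  proof (rule fundamental_theorem_of_calculus_interior_strong[OF \<open>finite S\<close> ab(1)])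
    show "continuous_on {a..b} (\<lambda>x. u x * \<eta> x)"
      by (intro continuous_intros continuous_on_subset[OF u] continuous_on_subset[OF ab(2)]) auto
    fix x assume "x \<in> {a<..<b} - S"
    then have "((\<lambda>x. u x * \<eta> x) has_real_derivative u x * deriv \<eta> x + v x * \<eta> x) (at x)"
      by (auto intro!: derivative_eq_intros deriv_u D)
    then show "((\<lambda>x. u x * \<eta> x) has_vector_derivative u x * deriv \<eta> x + v x * \<eta> x) (at x)"
      by (simp add: has_real_derivative_iff_has_vector_derivative)
  qed
  then have "((\<lambda>x. u x * deriv \<eta> x + v x * \<eta> x) has_integral 0) UNIV"
    unfolding z(1,2) mult_zero_right diff_self
  proof (rule has_integral_on_superset)
    show "u x * deriv \<eta> x + v x * \<eta> x = 0" if "x \<notin> {a..b}" for x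
      by (simp only: z(3,4)[OF that] mult_zero_right add_0_left)
  qed simp
  moreover have "((\<lambda>x. u x * deriv \<eta> x + v x * \<eta> x) has_integral
      (LINT x|lborel. u x * deriv \<eta> x + v x * \<eta> x)) UNIV"
    using I1 I2 by (intro has_integral_integral_lborel) simp
  ultimately have "(LINT x|lborel. u x * deriv \<eta> x + v x * \<eta> x) = 0"
    using has_integral_unique by blast
  with I1 I2 show "(LINT x|lborel. u x * deriv \<eta> x) = - (LINT x|lborel. v x * \<eta> x)"
    by simp
qed (rule v)

section \<open>Uniqueness of weak derivatives and the Sobolev norm\<close>

text \<open>
  The measures with densities the positive and the negative part of \<open>W\<close> are finite and agree on
  the half-lines, which generate the Borel sets. Hence they are equal, and so are their densities
  almost everywhere; but the two parts are never positive at the same point.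
\<close>

lemma integrable_zero_on_half_lines_imp_AE_zero:
  fixes W :: "real \<Rightarrow> real"
  assumes W: "integrable lborel W"
    and zero: "\<And>x. (LINT y|lborel. indicator {x<..} y * W y) = 0"
  shows "AE x in lborel. W x = 0"
proof -
  let ?p = "\<lambda>x. max 0 (W x)" and ?m = "\<lambda>x. max 0 (- W x)"
  have [measurable]: "W \<in> borel_measurable borel"
    using W by auto
  have int: "integrable lborel (\<lambda>y. indicator A y * ?p y)"
      "integrable lborel (\<lambda>y. indicator A y * ?m y)" if "A \<in> sets borel" for A
    using integrable_mult_indicator[of A lborel ?p] integrable_mult_indicator[of A lborel ?m] W that
    by simp_all
  have em: "emeasure (density lborel (\<lambda>x. ennreal (?p x))) {x<..} = ennreal (LINT y|lborel. indicator {x<..} y * ?p y)"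
           "emeasure (density lborel (\<lambda>x. ennreal (?m x))) {x<..} = ennreal (LINT y|lborel. indicator {x<..} y * ?m y)"
    for x
    by (simp_all add: emeasure_density nn_integral_eq_integral[symmetric] int)
       (auto intro!: nn_integral_cong simp: indicator_def)
  have eq: "(LINT y|lborel. indicator {x<..} y * ?p y) = (LINT y|lborel. indicator {x<..} y * ?m y)" for x
  proof -
    have "(LINT y|lborel. indicator {x<..} y * ?p y) - (LINT y|lborel. indicator {x<..} y * ?m y)
        = (LINT y|lborel. indicator {x<..} y * ?p y - indicator {x<..} y * ?m y)"
      by (rule Bochner_Integration.integral_diff[symmetric]) (auto intro!: int)
    also have "\<dots> = (LINT y|lborel. indicator {x<..} y * W y)"
      by (rule Bochner_Integration.integral_cong) (auto simp: indicator_def)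
    finally show ?thesis using zero by simp
  qed
  have "density lborel (\<lambda>x. ennreal (?p x)) = density lborel (\<lambda>x. ennreal (?m x))"
    by (rule measure_eqI_lessThan) (simp_all add: em eq)
  then have "AE x in lborel. ennreal (?p x) = ennreal (?m x)"
    by (subst (asm) sigma_finite_measure.density_unique_iff[OF sigma_finite_lborel]) auto
  then show ?thesis
    by eventually_elim (auto simp: max_def split: if_splits)
qed

text \<open>
  Dominated convergence along the bumps shows that \<open>w\<close> integrates to zero over every bounded open
  interval. The half-line criterion then applies to the truncations of \<open>w\<close>, which, unlike \<open>w\<close>,
  are integrable.
\<close>

lemma fundamental_lemma_calculus_of_variations:
  assumes w: "locally_integrable w"
    and zero: "\<And>\<eta>. test_function \<eta> \<Longrightarrow> (LINT x|lborel. w x * \<eta> x) = 0"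
  shows "AE x in lborel. w x = 0"
proof -
  have I: "integrable lborel (\<lambda>x. indicator {a..b} x * w x)" for a b
    using w by (simp add: locally_integrable_def set_integrable_def)
  have box: "integrable lborel (\<lambda>x. indicator {a<..<b} x * w x)" for a b
  proof -
    have "integrable lborel (\<lambda>x. (indicator {a..b} x * w x) * indicator {a<..<b} x)"
      using I by (intro integrable_real_mult_indicator) auto
    also have "(\<lambda>x. (indicator {a..b} x * w x) * indicator {a<..<b} x) = (\<lambda>x. indicator {a<..<b} x * w x)"
      by (auto simp: indicator_def)
    finally show ?thesis .
  qed
  have box0: "(LINT x|lborel. indicator {a<..<b} x * w x) = 0" for a b
  proof -
    have "(\<lambda>n. LINT x|lborel. w x * bump a b n x) \<longlonglongrightarrow> (LINT x|lborel. indicator {a<..<b} x * w x)"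
    proof (rule integral_dominated_convergence)
      show "integrable lborel (\<lambda>x. \<bar>indicator {a..b} x * w x\<bar>)"
        using I by (rule integrable_abs)
      show "AE x in lborel. (\<lambda>n. w x * bump a b n x) \<longlonglongrightarrow> indicator {a<..<b} x * w x"
        using tendsto_mult[OF tendsto_const bump_tendsto] by (intro AE_I2) (metis mult.commute)
      show "AE x in lborel. norm (w x * bump a b n x) \<le> \<bar>indicator {a..b} x * w x\<bar>" for n
        using mult_left_mono[OF bump_bounds[of a b n]]
        by (intro AE_I2) (simp add: abs_mult mult.commute)
    qed (use box w locally_integrable_mult_test_function[OF w bump_test_function] in auto)
    moreover have "(LINT x|lborel. w x * bump a b n x) = 0" for n
      by (rule zero) (rule bump_test_function)
    ultimately show ?thesis
      by (simp add: LIMSEQ_const_iff)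
  qed
  have "AE x in lborel. indicator {-real n<..<real n} x * w x = 0" for n :: nat
  proof (rule integrable_zero_on_half_lines_imp_AE_zero[OF box])
    fix x
    have "(\<lambda>y. indicator {x<..} y * (indicator {-real n<..<real n} y * w y)) =
          (\<lambda>y. indicator {max x (-real n)<..<real n} y * w y)"
      by (auto simp: indicator_def)
    then show "(LINT y|lborel. indicator {x<..} y * (indicator {-real n<..<real n} y * w y)) = 0"
      using box0 by simp
  qed
  then have "AE x in lborel. \<forall>n. indicator {-real n<..<real n} x * w x = 0"
    unfolding AE_all_countable by blast
  then show ?thesis
  proof eventually_elim
    case (elim x)
    obtain n where "\<bar>x\<bar> < real n" using reals_Archimedean2 by blast
    then have "x \<in> {-real n<..<real n}" by auto
    with elim show ?case by (metis indicator_simps(1) mult_1)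
  qed
qed

lemma weak_deriv_unique:
  assumes "has_weak_deriv u v" "has_weak_deriv u v'"
  shows "AE x in lborel. v x = v' x"
proof -
  have l: "locally_integrable v" "locally_integrable v'"
    using assms by (simp_all add: has_weak_deriv_def)
  have "AE x in lborel. v x - v' x = 0"
  proof (rule fundamental_lemma_calculus_of_variations)
    show "locally_integrable (\<lambda>x. v x - v' x)"
      using l by (simp add: locally_integrable_def set_integral_diff)
    fix \<eta> assume t: "test_function \<eta>"
    have "(LINT x|lborel. v x * \<eta> x) = (LINT x|lborel. v' x * \<eta> x)"
      using assms t by (simp add: has_weak_deriv_def)
    then show "(LINT x|lborel. (v x - v' x) * \<eta> x) = 0"
      using l t by (simp add: left_diff_distrib locally_integrable_mult_test_function)
  qed
  then show ?thesis by simp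
qed

lemma L2_imp_locally_integrable:
  assumes "u \<in> L2_space"
  shows "locally_integrable u"
  unfolding locally_integrable_def set_integrable_def
proof (intro allI impI)
  fix K :: "real set" assume K: "compact K"
  have [measurable]: "u \<in> borel_measurable lborel" "K \<in> sets lborel"
    and sq: "integrable lborel (\<lambda>x. (u x)\<^sup>2)"
    using assms K by (auto simp: L2_space_def compact_imp_closed borel_closed)
  show "integrable lborel (\<lambda>x. indicator K x *\<^sub>R u x)"
  proof (rule Bochner_Integration.integrable_bound)
    show "integrable lborel (\<lambda>x. indicator K x + (u x)\<^sup>2)"
      using sq emeasure_compact_finite[OF K] \<open>K \<in> sets lborel\<close>
      by (intro Bochner_Integration.integrable_add) (simp_all add: integrable_indicator_iff)
    show "AE x in lborel. norm (indicator K x *\<^sub>R u x) \<le> norm (indicator K x + (u x)\<^sup>2)"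
    proof (rule AE_I2)
      fix x
      have "\<bar>u x\<bar> \<le> 1 + (u x)\<^sup>2"
        using zero_le_power2[of "\<bar>u x\<bar> - 1"] by (simp add: power2_eq_square algebra_simps)
      then show "norm (indicator K x *\<^sub>R u x) \<le> norm (indicator K x + (u x)\<^sup>2)"
        by (simp add: indicator_def)
    qed
  qed measurable
qed

text \<open>
  By almost everywhere uniqueness of weak derivatives, the arbitrary choice in
  \<^const>\<open>weak_deriv\<close> may be replaced by any derivative that is at hand.
\<close>

lemma H1_norm_eq:
  assumes v: "v \<in> L2_space" "has_weak_deriv u v"
  shows "H1_norm u = sqrt ((LINT x|lborel. (u x)\<^sup>2) + (LINT x|lborel. (v x)\<^sup>2))"
proof -
  have w: "weak_deriv u \<in> L2_space \<and> has_weak_deriv u (weak_deriv u)"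
    unfolding weak_deriv_def by (rule someI[of _ v]) (use v in simp)
  then have "AE x in lborel. weak_deriv u x = v x"
    using v weak_deriv_unique by blast
  then have "(LINT x|lborel. (weak_deriv u x)\<^sup>2) = (LINT x|lborel. (v x)\<^sup>2)"
    by (intro integral_cong_AE) (use v w in \<open>auto simp: L2_space_def\<close>)
  then show ?thesis by (simp add: H1_norm_def)
qed

section \<open>Square integrability of exponentially decaying functions\<close>

lemma integrable_exp_neg_abs:
  assumes "a > 0"
  shows "integrable lborel (\<lambda>x::real. exp (- a * \<bar>x\<bar>))"
proof -
  let ?h = "\<lambda>x::real. indicator {0..} x * exp (- a * x)"
  have "set_integrable lebesgue {0..} (\<lambda>x::real. exp (- a * x))"
    using integrable_on_exp_minus_to_infinity[OF assms]
    by (intro nonnegative_absolutely_integrable_1) auto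
  then have h: "integrable lborel ?h"
    by (simp add: set_integrable_def integrable_completion)
  \<comment> \<open>A reflection covers the negative half-line; the overlap at \<open>0\<close> only enlarges the majorant.\<close>
  have "integrable lborel (\<lambda>x. ?h x + ?h (0 + (-1) * x))"
    using h by (intro Bochner_Integration.integrable_add lborel_integrable_real_affine) auto
  then show ?thesis
    by (rule Bochner_Integration.integrable_bound) (auto simp: indicator_def)
qed

lemma exponential_decay_square:
  fixes y :: real
  assumes "\<bar>y\<bar> \<le> B * exp (- a * t)"
  shows "y\<^sup>2 \<le> B\<^sup>2 * exp (- (2 * a) * t)"
proof -
  have "y\<^sup>2 \<le> (B * exp (- a * t))\<^sup>2"
    using power_mono[OF assms abs_ge_zero, of 2] by simp
  also have "\<dots> = B\<^sup>2 * exp (- (2 * a) * t)"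
    using exp_double[of "- a * t"] by (simp add: power_mult_distrib mult.assoc)
  finally show ?thesis .
qed

lemma exponential_decay_imp_L2:
  fixes u :: "real \<Rightarrow> real"
  assumes u: "u \<in> borel_measurable borel" and "a > 0"
    and bound: "\<And>x. \<bar>u x\<bar> \<le> B * exp (- a * \<bar>x\<bar>)"
  shows "u \<in> L2_space"
proof -
  have sq: "(u x)\<^sup>2 \<le> B\<^sup>2 * exp (- (2 * a) * \<bar>x\<bar>)" for x
    by (rule exponential_decay_square) (rule bound)
  have "integrable lborel (\<lambda>x. B\<^sup>2 * exp (- (2 * a) * \<bar>x\<bar>))"
    using integrable_exp_neg_abs[of "2 * a"] \<open>a > 0\<close> by (intro integrable_mult_right) simp
  then have "integrable lborel (\<lambda>x. (u x)\<^sup>2)"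
    by (rule Bochner_Integration.integrable_bound) (use u sq in auto)
  with u show ?thesis by (simp add: L2_space_def)
qed

lemma exponential_decay_L2_convergence:
  fixes u :: "nat \<Rightarrow> real \<Rightarrow> real"
  assumes u: "\<And>n. u n \<in> borel_measurable borel" and "a > 0"
    and bound: "\<And>n x. \<bar>u n x\<bar> \<le> B * exp (- a * \<bar>x\<bar>)"
    and lim: "\<And>x. (\<lambda>n. u n x) \<longlonglongrightarrow> 0"
  shows "(\<lambda>n. LINT x|lborel. (u n x)\<^sup>2) \<longlonglongrightarrow> 0"
proof -
  have sq: "(u n x)\<^sup>2 \<le> B\<^sup>2 * exp (- (2 * a) * \<bar>x\<bar>)" for n x
    by (rule exponential_decay_square) (rule bound)
  have lim2: "(\<lambda>n. (u n x)\<^sup>2) \<longlonglongrightarrow> 0" for x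
    using tendsto_power[OF lim, of x 2] by simp
  have int: "integrable lborel (\<lambda>x. B\<^sup>2 * exp (- (2 * a) * \<bar>x\<bar>))"
    using integrable_exp_neg_abs[of "2 * a"] \<open>a > 0\<close> by (intro integrable_mult_right) simp
  have "(\<lambda>n. LINT x|lborel. (u n x)\<^sup>2) \<longlonglongrightarrow> (LINT x::real|lborel. (0::real))"
    by (rule integral_dominated_convergence[OF _ _ int]) (use u sq lim2 in auto)
  then show ?thesis by simp
qed

section \<open>A family of exponential profiles\<close>

text \<open>
  After the exponentials in the hyperbolic cosine are expanded, the ground states and their limit
  belong to this one family; the limit is the case \<open>q = 0\<close>. No parameter degenerates in it,
  whereas amplitude and shift of the original formula diverge as the nonlinearity vanishes.
\<close>

definition profile :: "real \<Rightarrow> real \<Rightarrow> real \<Rightarrow> real \<Rightarrow> real" where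
  "profile k C q x = C * exp (- k * \<bar>x\<bar>) / (1 + q * exp (- 2 * k * \<bar>x\<bar>))"

definition profile_deriv :: "real \<Rightarrow> real \<Rightarrow> real \<Rightarrow> real \<Rightarrow> real" where
  "profile_deriv k C q x = - sgn x * k * C * exp (- k * \<bar>x\<bar>) *
     (1 - q * exp (- 2 * k * \<bar>x\<bar>)) / (1 + q * exp (- 2 * k * \<bar>x\<bar>))\<^sup>2"

lemma profile_denominator_pos: "q \<ge> 0 \<Longrightarrow> 0 < 1 + q * exp (y::real)"
  by (simp add: add_pos_nonneg)

lemma has_real_derivative_abs_sgn:
  fixes x :: real
  assumes "x \<noteq> 0"
  shows "(abs has_real_derivative sgn x) (at x)"
proof (cases "x > 0")
  case True
  have "((\<lambda>y. y) has_real_derivative 1) (at x)" by simp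
  then have "(abs has_real_derivative 1) (at x)"
    by (rule has_field_derivative_transform_within_open[of _ _ _ "{0<..}"]) (use True in auto)
  with True show ?thesis by simp
next
  case False
  have "((\<lambda>y. - y) has_real_derivative - 1) (at x)"
    by (auto intro!: derivative_eq_intros)
  then have "(abs has_real_derivative - 1) (at x)"
    by (rule has_field_derivative_transform_within_open[of _ _ _ "{..<0}"]) (use False assms in auto)
  with False assms show ?thesis by simp
qed

lemma profile_has_deriv:
  assumes "q \<ge> 0" "x \<noteq> 0"
  shows "(profile k C q has_real_derivative profile_deriv k C q x) (at x)"
proof -
  let ?D = "1 + q * exp (- 2 * k * \<bar>x\<bar>)"
  have D: "?D \<noteq> 0"
    using profile_denominator_pos[OF assms(1)] by (metis less_irrefl)
  have abs: "(abs has_real_derivative sgn x) (at x)"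
    using assms(2) by (rule has_real_derivative_abs_sgn)
  have E: "((\<lambda>x. exp (c * \<bar>x\<bar>)) has_real_derivative exp (c * \<bar>x\<bar>) * (c * sgn x)) (at x)" for c
    by (intro DERIV_chain2[OF DERIV_exp] DERIV_cmult abs)
  have "(profile k C q has_real_derivative
      ((C * (exp (- k * \<bar>x\<bar>) * (- k * sgn x))) * ?D -
       (C * exp (- k * \<bar>x\<bar>)) * (0 + q * (exp (- 2 * k * \<bar>x\<bar>) * (- 2 * k * sgn x)))) / (?D * ?D)) (at x)"
    unfolding profile_def by (intro DERIV_divide DERIV_cmult DERIV_add DERIV_const E D)
  also have "((C * (exp (- k * \<bar>x\<bar>) * (- k * sgn x))) * ?D -
       (C * exp (- k * \<bar>x\<bar>)) * (0 + q * (exp (- 2 * k * \<bar>x\<bar>) * (- 2 * k * sgn x)))) / (?D * ?D)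
      = profile_deriv k C q x"
    unfolding profile_deriv_def power2_eq_square
    by (rule arg_cong2[where f = "(/)"]) (simp_all add: algebra_simps)
  finally show ?thesis .
qed

lemma profile_continuous:
  assumes "q \<ge> 0"
  shows "continuous_on UNIV (profile k C q)"
  unfolding profile_def
  by (intro continuous_intros) (metis assms less_irrefl profile_denominator_pos)

lemma profile_bound:
  assumes "q \<ge> 0" "0 \<le> a" "a \<le> k"
  shows "\<bar>profile k C q x\<bar> \<le> \<bar>C\<bar> * exp (- a * \<bar>x\<bar>)"
proof -
  have "\<bar>profile k C q x\<bar> = \<bar>C\<bar> * exp (- k * \<bar>x\<bar>) / (1 + q * exp (- 2 * k * \<bar>x\<bar>))"
    using profile_denominator_pos[OF assms(1)] by (simp add: profile_def abs_mult abs_of_pos)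
  also have "\<dots> \<le> \<bar>C\<bar> * exp (- k * \<bar>x\<bar>) / 1"
    using assms by (intro divide_left_mono) (auto simp: profile_denominator_pos)
  also have "\<dots> \<le> \<bar>C\<bar> * exp (- a * \<bar>x\<bar>)"
    using assms by (auto intro!: mult_left_mono mult_right_mono)
  finally show ?thesis .
qed

text \<open>
  With \<open>t = q * exp (- 2 * k * \<bar>x\<bar>) \<ge> 0\<close>, the rational factor of the derivative is at most \<open>1\<close> in
  absolute value because \<open>\<bar>1 - t\<bar> \<le> 1 + t \<le> (1 + t)\<^sup>2\<close>.
\<close>

lemma profile_deriv_bound:
  assumes "q \<ge> 0" "0 \<le> a" "a \<le> k"
  shows "\<bar>profile_deriv k C q x\<bar> \<le> k * \<bar>C\<bar> * exp (- a * \<bar>x\<bar>)"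
proof -
  define t where "t = q * exp (- 2 * k * \<bar>x\<bar>)"
  have t: "t \<ge> 0" using assms by (simp add: t_def)
  have "\<bar>1 - t\<bar> \<le> (1 + t)\<^sup>2"
    using t by (simp add: power2_eq_square algebra_simps abs_le_iff)
  then have le: "\<bar>1 - t\<bar> / (1 + t)\<^sup>2 \<le> 1"
    using t by (simp add: divide_le_eq_1)
  have "\<bar>profile_deriv k C q x\<bar> = \<bar>sgn x\<bar> * (k * \<bar>C\<bar> * exp (- k * \<bar>x\<bar>) * (\<bar>1 - t\<bar> / (1 + t)\<^sup>2))"
    using assms unfolding profile_deriv_def t_def[symmetric] by (simp add: abs_mult)
  also have "\<dots> \<le> 1 * (k * \<bar>C\<bar> * exp (- a * \<bar>x\<bar>) * 1)"
    using assms le by (intro mult_mono mult_nonneg_nonneg) (auto simp: abs_sgn_eq intro!: mult_right_mono)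
  finally show ?thesis by simp
qed

lemma profile_measurable:
  "profile k C q \<in> borel_measurable borel" "profile_deriv k C q \<in> borel_measurable borel"
proof -
  show "profile k C q \<in> borel_measurable borel"
    unfolding profile_def[abs_def] by measurable
  have [measurable]: "(sgn :: real \<Rightarrow> real) \<in> borel_measurable borel"
    unfolding sgn_if[abs_def] by measurable
  show "profile_deriv k C q \<in> borel_measurable borel"
    unfolding profile_deriv_def[abs_def] by measurable
qed

lemma profile_in_H1:
  assumes "q \<ge> 0" "k > 0"
  shows "profile k C q \<in> H1_space"
proof -
  have L2: "profile k C q \<in> L2_space" "profile_deriv k C q \<in> L2_space"
    using assms
    by (auto intro!: exponential_decay_imp_L2 profile_measurable profile_bound profile_deriv_bound)
  have "has_weak_deriv (profile k C q) (profile_deriv k C q)"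
    using assms L2
    by (intro has_weak_deriv_piecewise[of "{0}"] profile_continuous L2_imp_locally_integrable)
       (auto intro: profile_has_deriv)
  with L2 show ?thesis by (auto simp: H1_space_def)
qed

lemma H1_norm_profile_diff:
  assumes "q \<ge> 0" "k > 0" "q' \<ge> 0" "k' > 0"
  shows "H1_norm (\<lambda>x. profile k C q x - profile k' C' q' x) =
    sqrt ((LINT x|lborel. (profile k C q x - profile k' C' q' x)\<^sup>2) +
          (LINT x|lborel. (profile_deriv k C q x - profile_deriv k' C' q' x)\<^sup>2))"
proof (rule H1_norm_eq)
  let ?a = "min k k'"
  show L2: "(\<lambda>x. profile_deriv k C q x - profile_deriv k' C' q' x) \<in> L2_space"
  proof (rule exponential_decay_imp_L2)
    fix x
    have "\<bar>profile_deriv k C q x\<bar> \<le> k * \<bar>C\<bar> * exp (- ?a * \<bar>x\<bar>)"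
      "\<bar>profile_deriv k' C' q' x\<bar> \<le> k' * \<bar>C'\<bar> * exp (- ?a * \<bar>x\<bar>)"
      by (rule profile_deriv_bound; use assms in simp)+
    then show "\<bar>profile_deriv k C q x - profile_deriv k' C' q' x\<bar>
        \<le> (k * \<bar>C\<bar> + k' * \<bar>C'\<bar>) * exp (- ?a * \<bar>x\<bar>)"
      unfolding distrib_right by linarith
  qed (use assms in \<open>auto intro!: borel_measurable_diff profile_measurable\<close>)
  show "has_weak_deriv (\<lambda>x. profile k C q x - profile k' C' q' x)
      (\<lambda>x. profile_deriv k C q x - profile_deriv k' C' q' x)"
    using assms L2
    by (intro has_weak_deriv_piecewise[of "{0}"] continuous_intros profile_continuous
          L2_imp_locally_integrable) (auto intro!: DERIV_diff profile_has_deriv)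
qed

text \<open>
  Continuity of the profile and of its derivative in the parameters gives pointwise convergence.
  The uniform lower bound \<open>a\<close> on the decay rates and the boundedness of convergent parameter
  sequences give a common exponential majorant, so dominated convergence applies to the squares
  of both differences.
\<close>

lemma profile_H1_convergence:
  fixes k C q :: "nat \<Rightarrow> real"
  assumes lim: "k \<longlonglongrightarrow> k0" "C \<longlonglongrightarrow> C0" "q \<longlonglongrightarrow> q0"
    and q: "\<And>n. q n \<ge> 0" and a: "a > 0" and k: "\<And>n. k n \<ge> a"
  shows "(\<lambda>n. H1_norm (\<lambda>x. profile (k n) (C n) (q n) x - profile k0 C0 q0 x)) \<longlonglongrightarrow> 0"
proof -
  have k0: "k0 \<ge> a" and q0: "q0 \<ge> 0"
    using LIMSEQ_le_const[OF lim(1)] LIMSEQ_le_const[OF lim(3)] k q by blast+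
  obtain M where M: "\<And>n. \<bar>C n\<bar> \<le> M"
    using convergent_imp_Bseq[OF convergentI[OF lim(2)]] by (metis BseqE real_norm_def)
  obtain K where K: "\<And>n. \<bar>k n\<bar> \<le> K"
    using convergent_imp_Bseq[OF convergentI[OF lim(1)]] by (metis BseqE real_norm_def)
  have D: "1 + q0 * exp y \<noteq> 0" for y :: real
    using profile_denominator_pos[OF q0] by (metis less_irrefl)
  have "(\<lambda>n. LINT x|lborel. (profile (k n) (C n) (q n) x - profile k0 C0 q0 x)\<^sup>2) \<longlonglongrightarrow> 0"
  proof (rule exponential_decay_L2_convergence[OF _ a])
    fix n x
    have "\<bar>profile (k n) (C n) (q n) x\<bar> \<le> \<bar>C n\<bar> * exp (- a * \<bar>x\<bar>)"
      using a q k by (intro profile_bound) auto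
    also have "\<dots> \<le> M * exp (- a * \<bar>x\<bar>)"
      using M by (intro mult_right_mono) auto
    finally have "\<bar>profile (k n) (C n) (q n) x\<bar> \<le> M * exp (- a * \<bar>x\<bar>)" .
    moreover have "\<bar>profile k0 C0 q0 x\<bar> \<le> \<bar>C0\<bar> * exp (- a * \<bar>x\<bar>)"
      using a q0 k0 by (intro profile_bound) auto
    ultimately show "\<bar>profile (k n) (C n) (q n) x - profile k0 C0 q0 x\<bar> \<le> (M + \<bar>C0\<bar>) * exp (- a * \<bar>x\<bar>)"
      unfolding distrib_right by linarith
  next
    fix x
    have "(\<lambda>n. profile (k n) (C n) (q n) x) \<longlonglongrightarrow> profile k0 C0 q0 x"
      unfolding profile_def by (intro tendsto_intros lim D)
    then show "(\<lambda>n. profile (k n) (C n) (q n) x - profile k0 C0 q0 x) \<longlonglongrightarrow> 0"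
      by (simp add: LIM_zero)
  qed (intro borel_measurable_diff profile_measurable)
  moreover have "(\<lambda>n. LINT x|lborel. (profile_deriv (k n) (C n) (q n) x - profile_deriv k0 C0 q0 x)\<^sup>2) \<longlonglongrightarrow> 0"
  proof (rule exponential_decay_L2_convergence[OF _ a])
    fix n x
    have "\<bar>profile_deriv (k n) (C n) (q n) x\<bar> \<le> k n * \<bar>C n\<bar> * exp (- a * \<bar>x\<bar>)"
      using a q k by (intro profile_deriv_bound) auto
    also have "\<dots> \<le> K * M * exp (- a * \<bar>x\<bar>)"
    proof -
      have "k n \<le> K" "0 \<le> k n"
        using K[of n] k[of n] a by auto
      then show ?thesis
        using M by (intro mult_right_mono mult_mono) auto
    qed
    finally have "\<bar>profile_deriv (k n) (C n) (q n) x\<bar> \<le> K * M * exp (- a * \<bar>x\<bar>)" .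
    moreover have "\<bar>profile_deriv k0 C0 q0 x\<bar> \<le> k0 * \<bar>C0\<bar> * exp (- a * \<bar>x\<bar>)"
      using a q0 k0 by (intro profile_deriv_bound) auto
    ultimately show "\<bar>profile_deriv (k n) (C n) (q n) x - profile_deriv k0 C0 q0 x\<bar>
        \<le> (K * M + k0 * \<bar>C0\<bar>) * exp (- a * \<bar>x\<bar>)"
      unfolding distrib_right by linarith
  next
    fix x
    have "(\<lambda>n. profile_deriv (k n) (C n) (q n) x) \<longlonglongrightarrow> profile_deriv k0 C0 q0 x"
      unfolding profile_deriv_def by (intro tendsto_intros lim power_not_zero D)
    then show "(\<lambda>n. profile_deriv (k n) (C n) (q n) x - profile_deriv k0 C0 q0 x) \<longlonglongrightarrow> 0"
      by (simp add: LIM_zero)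
  qed (intro borel_measurable_diff profile_measurable)
  ultimately have "(\<lambda>n. sqrt ((LINT x|lborel. (profile (k n) (C n) (q n) x - profile k0 C0 q0 x)\<^sup>2) +
      (LINT x|lborel. (profile_deriv (k n) (C n) (q n) x - profile_deriv k0 C0 q0 x)\<^sup>2))) \<longlonglongrightarrow> sqrt (0 + 0)"
    by (intro tendsto_intros)
  moreover have "k n > 0" "k0 > 0" for n
    using k[of n] k0 a by auto
  ultimately show ?thesis
    using q q0 by (simp add: H1_norm_profile_diff)
qed

section \<open>Ground states for vanishing nonlinearity\<close>

text \<open>
  Write \<open>k = l * \<rho> / 4 + \<alpha> / 2\<close> for the decay rate and \<open>A\<close> for the amplitude. The product of \<open>k\<close>
  and the shift is \<open>ln (sqrt q)\<close>, so with \<open>E = exp (- k * \<bar>x\<bar>)\<close> the hyperbolic secant equals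
  \<open>2 * sqrt q * E / (1 + q * E\<^sup>2)\<close>. The divergent amplitude and the vanishing factor \<open>sqrt q\<close>
  combine to the coefficient \<open>2 * A * sqrt q\<close>, which has a finite limit.
\<close>

lemma ground_state_eq_profile:
  assumes "\<alpha> > 0" "\<rho> > 0" "l > 0"
  shows "ground_state \<alpha> \<rho> l =
    profile (l * \<rho> / 4 + \<alpha> / 2) ((l * \<rho> + 2 * \<alpha>) * sqrt (\<rho> / (2 * (l * \<rho> + 4 * \<alpha>))))
      (l * \<rho> / (l * \<rho> + 4 * \<alpha>))"
proof
  fix x
  define k where "k = l * \<rho> / 4 + \<alpha> / 2"
  define q where "q = l * \<rho> / (l * \<rho> + 4 * \<alpha>)"
  define A where "A = sqrt l * \<rho> / (2 * sqrt 2) + \<alpha> / sqrt (2 * l)"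
  have pos: "l * \<rho> > 0" "q > 0" "sqrt q > 0" "sqrt l > 0"
    using assms by (auto simp: q_def intro!: divide_pos_pos add_pos_pos mult_pos_pos)
  have ks: "k * ground_state_shift \<alpha> \<rho> l = ln (sqrt q)"
  proof -
    have "k * (2 / (l * \<rho> + 2 * \<alpha>)) = 1 / 2"
    proof -
      have "k = (l * \<rho> + 2 * \<alpha>) / 4" "l * \<rho> + 2 * \<alpha> > 0"
        using assms(1) pos(1) by (simp_all add: k_def add_pos_pos)
      then show ?thesis by simp
    qed
    then show ?thesis
      using pos by (simp add: ground_state_shift_def ln_sqrt flip: q_def mult.assoc)
  qed
  have A: "2 * A * sqrt q = (l * \<rho> + 2 * \<alpha>) * sqrt (\<rho> / (2 * (l * \<rho> + 4 * \<alpha>)))"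
  proof -
    have "2 * A = (l * \<rho> + 2 * \<alpha>) / (sqrt 2 * sqrt l)"
    proof -
      have "sqrt l * sqrt l = l" using assms by simp
      then show ?thesis
        using pos unfolding A_def by (simp add: field_simps real_sqrt_mult)
    qed
    moreover have "sqrt q / (sqrt 2 * sqrt l) = sqrt (q / (2 * l))"
      by (simp add: real_sqrt_divide real_sqrt_mult)
    moreover have "q / (2 * l) = \<rho> / (2 * (l * \<rho> + 4 * \<alpha>))"
      using assms by (simp add: q_def)
    ultimately show ?thesis
      by (metis times_divide_eq_left times_divide_eq_right)
  qed
  define E where "E = exp (- k * \<bar>x\<bar>)"
  have E: "E > 0" "exp (k * \<bar>x\<bar>) = 1 / E"
    by (simp_all add: E_def exp_minus divide_inverse)
  have EE: "exp (- 2 * k * \<bar>x\<bar>) = E * E"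
    by (simp add: E_def flip: exp_add)
  have e: "exp (k * \<bar>x\<bar> - ln (sqrt q)) = 1 / (E * sqrt q)"
    using pos E by (simp add: exp_diff)
  moreover have "exp (- (k * \<bar>x\<bar> - ln (sqrt q))) = E * sqrt q"
    unfolding exp_minus e by simp
  ultimately have "cosh (k * \<bar>x\<bar> - ln (sqrt q)) = (1 / (E * sqrt q) + E * sqrt q) / 2"
    by (simp add: cosh_field_def)
  also have "\<dots> = (1 + q * (E * E)) / (2 * sqrt q * E)"
    using pos E by (simp add: field_simps)
  finally have "A / cosh (k * \<bar>x\<bar> - ln (sqrt q)) = (2 * A * sqrt q) * E / (1 + q * (E * E))"
    by simp
  moreover have "ground_state \<alpha> \<rho> l x = A / cosh (k * \<bar>x\<bar> - ln (sqrt q))"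
    by (simp add: ground_state_def sech_def right_diff_distrib flip: A_def k_def ks)
  ultimately show "ground_state \<alpha> \<rho> l x =
    profile (l * \<rho> / 4 + \<alpha> / 2) ((l * \<rho> + 2 * \<alpha>) * sqrt (\<rho> / (2 * (l * \<rho> + 4 * \<alpha>))))
      (l * \<rho> / (l * \<rho> + 4 * \<alpha>)) x"
    unfolding A by (simp only: profile_def EE flip: k_def q_def E_def)
qed

theorem theorem2p2:
  fixes \<alpha> \<rho> :: real
  assumes "\<alpha> > 0" and "\<rho> > 0"
  shows "(\<forall>l>0. ground_state \<alpha> \<rho> l \<in> H1_space) \<and>
         (\<lambda>x. sqrt (\<rho> * \<alpha> / 2) * exp (- (\<alpha> / 2) * \<bar>x\<bar>)) \<in> H1_space \<and>
         ((\<lambda>l. H1_norm (\<lambda>x. ground_state \<alpha> \<rho> l x - sqrt (\<rho> * \<alpha> / 2) * exp (- (\<alpha> / 2) * \<bar>x\<bar>)))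
            \<longlongrightarrow> 0) (at_right 0)"
proof (intro conjI allI impI)
  let ?C = "sqrt (\<rho> * \<alpha> / 2)"
  have limit: "(\<lambda>x. ?C * exp (- (\<alpha> / 2) * \<bar>x\<bar>)) = profile (\<alpha> / 2) ?C 0"
    by (simp add: profile_def fun_eq_iff)
  show "(\<lambda>x. ?C * exp (- (\<alpha> / 2) * \<bar>x\<bar>)) \<in> H1_space"
    unfolding limit using assms by (intro profile_in_H1) auto
  show "ground_state \<alpha> \<rho> l \<in> H1_space" if "l > 0" for l
    unfolding ground_state_eq_profile[OF assms that]
    using assms that by (intro profile_in_H1) (auto intro!: add_pos_pos)
  show "((\<lambda>l. H1_norm (\<lambda>x. ground_state \<alpha> \<rho> l x - ?C * exp (- (\<alpha> / 2) * \<bar>x\<bar>))) \<longlongrightarrow> 0) (at_right 0)"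
  proof (rule tendsto_at_right_sequentially[of 0 1])
    fix l :: "nat \<Rightarrow> real"
    assume l: "\<And>n. 0 < l n" and l0: "l \<longlonglongrightarrow> 0"
    have "(\<lambda>n. H1_norm (\<lambda>x.
        profile (l n * \<rho> / 4 + \<alpha> / 2) ((l n * \<rho> + 2 * \<alpha>) * sqrt (\<rho> / (2 * (l n * \<rho> + 4 * \<alpha>))))
          (l n * \<rho> / (l n * \<rho> + 4 * \<alpha>)) x - profile (\<alpha> / 2) ?C 0 x)) \<longlonglongrightarrow> 0"
    proof (rule profile_H1_convergence[where a = "\<alpha> / 2"])
      have "(\<lambda>n. l n * \<rho> / 4 + \<alpha> / 2) \<longlonglongrightarrow> 0 * \<rho> / 4 + \<alpha> / 2"
        by (intro tendsto_intros l0) simp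
      then show "(\<lambda>n. l n * \<rho> / 4 + \<alpha> / 2) \<longlonglongrightarrow> \<alpha> / 2" by simp
      have "(\<lambda>n. l n * \<rho> / (l n * \<rho> + 4 * \<alpha>)) \<longlonglongrightarrow> 0 * \<rho> / (0 * \<rho> + 4 * \<alpha>)"
        using assms by (intro tendsto_intros l0) simp
      then show "(\<lambda>n. l n * \<rho> / (l n * \<rho> + 4 * \<alpha>)) \<longlonglongrightarrow> 0" by simp
      have "(\<lambda>n. (l n * \<rho> + 2 * \<alpha>) * sqrt (\<rho> / (2 * (l n * \<rho> + 4 * \<alpha>)))) \<longlonglongrightarrow>
          (0 * \<rho> + 2 * \<alpha>) * sqrt (\<rho> / (2 * (0 * \<rho> + 4 * \<alpha>)))"
        using assms by (intro tendsto_intros l0) simp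
      also have "(0 * \<rho> + 2 * \<alpha>) * sqrt (\<rho> / (2 * (0 * \<rho> + 4 * \<alpha>))) = sqrt ((2 * \<alpha>)\<^sup>2 * (\<rho> / (8 * \<alpha>)))"
        using assms(1) by (simp only: real_sqrt_mult real_sqrt_abs) simp
      also have "(2 * \<alpha>)\<^sup>2 * (\<rho> / (8 * \<alpha>)) = \<rho> * \<alpha> / 2"
        using assms by (simp add: power2_eq_square)
      finally show "(\<lambda>n. (l n * \<rho> + 2 * \<alpha>) * sqrt (\<rho> / (2 * (l n * \<rho> + 4 * \<alpha>)))) \<longlonglongrightarrow> ?C" .
    qed (use assms l in \<open>auto simp: less_imp_le\<close>)
    then show "(\<lambda>n. H1_norm (\<lambda>x. ground_state \<alpha> \<rho> (l n) x - ?C * exp (- (\<alpha> / 2) * \<bar>x\<bar>))) \<longlonglongrightarrow> 0"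
      by (simp only: ground_state_eq_profile[OF assms l] fun_cong[OF limit])
  qed simp
qed

end
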